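(* Let $H=E_0+P_0$ with $E_0=\langle\omega_0(\xi),y\rangle+\langle\Omega z,\bar z\rangle$, $\Omega=\mathrm{diag}(\Omega_1,\dots,\Omega_n)$, $\Omega_j>0$, satisfy Assumptions A, B, C, D listed in the context, and assume $$ {}_{r_0}|X_{P_0}|_{\mathscr D(s_0,r_0)\times\mathscr O_0}<\epsilon,\qquad {}_{r_0}|X_{P_0}|^{\mathcal L}_{\mathscr D(s_0,r_0)\times\mathscr O_0}<\epsilon^{1/3} $$ with $0<\epsilon<\epsilon_*$, where $\epsilon_*=\epsilon_*(n,d,r_0,s_0,\rho_0,\Pi_0)>0$ is sufficiently small. Then the perturbed invariant tori of $H$ (described in the context, one for each $\xi\in\Pi_\infty$) are linearly stable in the sense that the associated Lyapunov exponent is zero.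
   Context: Phase space: $\mathcal P=\mathbb T^d\times\mathbb R^d\times\mathbb C^n\times\mathbb C^n\ni(x,y,z,\bar z)$, $\mathbb T^d=\mathbb R^d/(2\pi\mathbb Z)^d$, with symplectic form $\sum_{j}dx_j\wedge dy_j+\sqrt{-1}\sum_k dz_k\wedge d\bar z_k$; its complexification is $\mathcal P_{\mathbb C}=(\mathbb C^d/2\pi\mathbb Z^d)\times\mathbb C^d\times\mathbb C^n\times\mathbb C^n$, on which $z$ and $\bar z$ are independent. $\langle a,b\rangle=\sum_j a_jb_j$. $X_H=(\partial_yH,-\partial_xH,\sqrt{-1}\,\partial_{\bar z}H,-\sqrt{-1}\,\partial_zH)^T$. $|\cdot|$ is the Euclidean norm, $|\cdot|_\infty$ the sup norm, $\mathrm{mes}$ is Lebesgue measure. Domains: $\mathscr D(s,r)=\{(x,y,z,\bar z)\in\mathcal P_{\mathbb C}:|\mathrm{Im}\,x|_\infty<s,\ |y|<r^2,\ |z|<r,\ |\bar z|<r\}$; $\mathscr D_{\mathbb R}(s,r)$ is the subset with $x,y$ real and $z,\bar z$ complex conjugate to each other. $\Pi_0=\{\xi\in\mathbb R^d:a_j<\xi_j<b_j\}$ is an open box and $\mathscr O_0=\{z\in\mathbb C^d:|z-\xi|<\rho_0\text{ for some }\xi\in\Pi_0\}$, $\rho_0>0$. Norms: for $W=(X,Y,Z,\bar Z)$, ${}_r|W|=|X|+r^{-2}|Y|+r^{-1}|Z|+r^{-1}|\bar Z|$; ${}_r|W|_{\mathscr D(s,r)\times\mathscr O}=\sup{}_r|W(u,\xi)|$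 and ${}_r|W|^{\mathcal L}_{\mathscr D(s,r)\times\mathscr O}=\sup{}_r|\partial_\xi W(u,\xi)|$ over $(u,\xi)\in\mathscr D(s,r)\times\mathscr O$. "Real analytic" on a complex domain means analytic there and real valued for real arguments (for Hamiltonians: when $x,y$ are real and $z,\bar z$ are complex conjugate). Assumption A: $\omega_0$ is real analytic in $\xi$ on $\mathscr O_0$. Assumption B: there is an absolute constant $C>0$ with $\sup_{\mathscr O_0}|\partial_\xi\omega_0|<C$ and $\sup_{\mathscr O_0}|\partial_\xi\omega_0^{-1}|<C$. Assumption C: $s_0,r_0>0$; $P_0$ is real analytic in $(x,y,z,\bar z)$ on $\mathscr D(s_0,r_0)$; for each $\xi\in\mathscr O_0$ the vector field $X_{P_0}$ defines an analytic map $\mathscr D(s_0,r_0)\to\mathcal P_{\mathbb C}$; $X_{P_0}$ is real analytic in $\xi\in\mathscr O_0$. Assumption D: $\overline{P_0}=P_0$ on $\mathscr D_{\mathbb R}(s_0,r_0)\times\Pi_0$. The perturbed tori: under these hypotheses there are a subset $\Pi_\infty\subset\Pi_0$ with $\mathrm{mes}(\Pi_\infty)\ge(1-O(\epsilon^{1/2}))\mathrm{mes}(\Pi_0)$ and, for each $\xi\in\Pi_\infty$, a vector $\omega_*(\xi)\in\mathbb R^d$, a matrix function $B^{z\bar z}(x;\xi)$ ($n\times n$, real analytic in $x$ on $|\mathrm{Im}\,x|_\infty<s_0/2$) and a real analytic symplectic change of variables $\Phi(\cdot;\xi)$ near $\mathcal T_0^d=\mathbb T^d\times\{y=0\}\times\{z=0\}\times\{\bar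 z=0\}$ such that, up to an additive constant, $H\circ\Phi=\langle\omega_*(\xi),y\rangle+\langle\Omega z,\bar z\rangle+\langle B^{z\bar z}(x;\xi)z,\bar z\rangle+O(|y||z|+|y|^2+|z|^3)$. The perturbed invariant torus for $\xi$ is $\Phi(\mathcal T_0^d;\xi)$; it carries the rotation flow with frequency $\omega_*(\xi)$. Its linear stability refers to the linearized equation around $\mathcal T_0^d$ of the vector field $X_{H\circ\Phi}$, namely $\dot x=\omega_*$, $\dot y=0$, $\dot z=\sqrt{-1}(\Omega+B^{z\bar z}(x))z$, $\dot{\bar z}=-\sqrt{-1}(\Omega+B^{z\bar z}(x))\bar z$. *)

theory Defs
  imports "HOL-Analysis.Analysis"
begin

section \<open>Analytic maps of several complex variables\<close>

class complex_vec = real_normed_vector +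
  fixes scaleC :: "complex \<Rightarrow> 'a \<Rightarrow> 'a"
  assumes scaleC_of_real: "scaleC (of_real a) x = a *\<^sub>R x"
    and scaleC_add_left: "scaleC (c + c') x = scaleC c x + scaleC c' x"
    and scaleC_add_right: "scaleC c (x + y) = scaleC c x + scaleC c y"
    and scaleC_scaleC: "scaleC c (scaleC c' x) = scaleC (c * c') x"

instantiation complex :: complex_vec
begin
definition scaleC_complex :: "complex \<Rightarrow> complex \<Rightarrow> complex"
  where "scaleC_complex c x = c * x"
instance
  by standard (simp_all add: scaleC_complex_def algebra_simps scaleR_conv_of_real)
end

instantiation vec :: (complex_vec, finite) complex_vec
begin
definition scaleC_vec :: "complex \<Rightarrow> 'a ^ 'b \<Rightarrow> 'a ^ 'b"
  where "scaleC_vec c x = (\<chi> i. scaleC c (x $ i))"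
instance
  by standard
    (simp_all add: scaleC_vec_def vec_eq_iff scaleC_of_real scaleC_add_left
      scaleC_add_right scaleC_scaleC)
end

instantiation prod :: (complex_vec, complex_vec) complex_vec
begin
definition scaleC_prod :: "complex \<Rightarrow> 'a \<times> 'b \<Rightarrow> 'a \<times> 'b"
  where "scaleC_prod c x = (scaleC c (fst x), scaleC c (snd x))"
instance
  by standard
    (simp_all add: scaleC_prod_def prod_eq_iff scaleC_of_real scaleC_add_left
      scaleC_add_right scaleC_scaleC)
end

text \<open>As for the library's \<^const>\<open>holomorphic_on\<close> in one variable, analyticity on an open set
  is complex (Frechet) differentiability at each of its points.\<close>

definition complex_analytic_on :: "('a::complex_vec \<Rightarrow> 'b::complex_vec) \<Rightarrow> 'a set \<Rightarrow> bool"
  where "complex_analytic_on f S \<longleftrightarrow>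
    open S \<and> (\<forall>u\<in>S. \<exists>D. (f has_derivative D) (at u) \<and> (\<forall>c h. D (scaleC c h) = scaleC c (D h)))"


section \<open>Phase space\<close>

text \<open>Points of the complexified phase space are written in the lift \<open>x \<in> \<complex>\<^sup>d\<close> of the angle;
  \<open>same_point\<close> is equality in the quotient by \<open>2 \<pi> \<int>\<^sup>d\<close>.  The last component is the
  coordinate \<open>\<bar>z\<close>, independent of \<open>z\<close>.\<close>

type_synonym ('d, 'n) phase =
  "(complex ^ 'd) \<times> (complex ^ 'd) \<times> (complex ^ 'n) \<times> (complex ^ 'n)"

definition cvec :: "real ^ 'k \<Rightarrow> complex ^ 'k"
  where "cvec v = (\<chi> j. complex_of_real (v $ j))"

definition cnj_vec :: "complex ^ 'k \<Rightarrow> complex ^ 'k"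
  where "cnj_vec v = (\<chi> j. cnj (v $ j))"

definition same_angle :: "complex ^ 'd \<Rightarrow> complex ^ 'd \<Rightarrow> bool"
  where "same_angle x x' \<longleftrightarrow> (\<exists>k :: int ^ 'd. \<forall>j. x' $ j = x $ j + 2 * of_real pi * of_int (k $ j))"

definition same_point :: "('d::finite, 'n::finite) phase \<Rightarrow> ('d, 'n) phase \<Rightarrow> bool"
  where "same_point u v \<longleftrightarrow> same_angle (fst u) (fst v) \<and> snd u = snd v"

definition strip :: "real \<Rightarrow> (complex ^ 'd) set"
  where "strip s = {x. \<forall>j. \<bar>Im (x $ j)\<bar> < s}"

definition cdom :: "real \<Rightarrow> real \<Rightarrow> ('d::finite, 'n::finite) phase set"
  where "cdom s r = {(x, y, z, zb). x \<in> strip s \<and> norm y < r\<^sup>2 \<and> norm z < r \<and> norm zb < r}"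

definition real_points :: "('d::finite, 'n::finite) phase set"
  where "real_points = {(x, y, z, zb). x \<in> range cvec \<and> y \<in> range cvec \<and> zb = cnj_vec z}"

definition real_dom :: "real \<Rightarrow> real \<Rightarrow> ('d::finite, 'n::finite) phase set"
  where "real_dom s r = cdom s r \<inter> real_points"

definition param_dom :: "real \<Rightarrow> (real ^ 'd) set \<Rightarrow> (complex ^ 'd::finite) set"
  where "param_dom \<rho> S = {\<zeta>. \<exists>\<xi>\<in>S. norm (\<zeta> - cvec \<xi>) < \<rho>}"

definition bil :: "complex ^ 'k \<Rightarrow> complex ^ 'k \<Rightarrow> complex"
  where "bil a b = (\<Sum>j\<in>UNIV. a $ j * b $ j)"

definition diag :: "real ^ 'n \<Rightarrow> complex ^ 'n ^ 'n"
  where "diag \<Omega> = (\<chi> i j. if i = j then complex_of_real (\<Omega> $ i) else 0)"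

definition sympl :: "('d::finite, 'n::finite) phase \<Rightarrow> ('d, 'n) phase \<Rightarrow> complex"
  where "sympl = (\<lambda>(x, y, z, zb) (x', y', z', zb').
    (bil x y' - bil x' y) + \<i> * (bil z zb' - bil z' zb))"


section \<open>Hamiltonian vector fields and weighted norms\<close>

definition grad :: "(complex ^ 'k \<Rightarrow> complex) \<Rightarrow> complex ^ 'k \<Rightarrow> complex ^ 'k"
  where "grad f v = (\<chi> j. deriv (\<lambda>t. f (v + axis j t)) 0)"

definition ham_vf :: "(('d::finite, 'n::finite) phase \<Rightarrow> complex) \<Rightarrow> ('d, 'n) phase \<Rightarrow> ('d, 'n) phase"
  where "ham_vf H = (\<lambda>(x, y, z, zb).
    (grad (\<lambda>y'. H (x, y', z, zb)) y,
     - grad (\<lambda>x'. H (x', y, z, zb)) x,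
     scaleC \<i> (grad (\<lambda>zb'. H (x, y, z, zb')) zb),
     - scaleC \<i> (grad (\<lambda>z'. H (x, y, z', zb)) z)))"

definition weighted_norm :: "real \<Rightarrow> ('d::finite, 'n::finite) phase \<Rightarrow> real"
  where "weighted_norm r = (\<lambda>(X, Y, Z, Zb).
    norm X + norm Y / r\<^sup>2 + norm Z / r + norm Zb / r)"

text \<open>The weighted norm of \<open>\<partial>\<^sub>\<xi> W\<close>; each Jacobian block is measured by the operator norm
  induced by the Euclidean norms.\<close>

definition weighted_deriv_norm ::
    "real \<Rightarrow> (complex ^ 'd \<Rightarrow> ('d::finite, 'n::finite) phase) \<Rightarrow> complex ^ 'd \<Rightarrow> real"
  where "weighted_deriv_norm r W \<xi> =
      onorm (frechet_derivative (\<lambda>\<xi>. fst (W \<xi>)) (at \<xi>))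
    + onorm (frechet_derivative (\<lambda>\<xi>. fst (snd (W \<xi>))) (at \<xi>)) / r\<^sup>2
    + onorm (frechet_derivative (\<lambda>\<xi>. fst (snd (snd (W \<xi>)))) (at \<xi>)) / r
    + onorm (frechet_derivative (\<lambda>\<xi>. snd (snd (snd (W \<xi>)))) (at \<xi>)) / r"

text \<open>Vector fields depending on parameters are curried with the parameter first.\<close>

definition sup_norm_vf ::
    "real \<Rightarrow> (complex ^ 'd \<Rightarrow> ('d, 'n) phase \<Rightarrow> ('d, 'n) phase) \<Rightarrow>
     ('d::finite, 'n::finite) phase set \<Rightarrow> (complex ^ 'd) set \<Rightarrow> ennreal"
  where "sup_norm_vf r W D Q = (SUP (u, \<xi>)\<in>D \<times> Q. ennreal (weighted_norm r (W \<xi> u)))"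

definition sup_deriv_norm_vf ::
    "real \<Rightarrow> (complex ^ 'd \<Rightarrow> ('d, 'n) phase \<Rightarrow> ('d, 'n) phase) \<Rightarrow>
     ('d::finite, 'n::finite) phase set \<Rightarrow> (complex ^ 'd) set \<Rightarrow> ennreal"
  where "sup_deriv_norm_vf r W D Q =
    (SUP (u, \<xi>)\<in>D \<times> Q. ennreal (weighted_deriv_norm r (\<lambda>\<xi>. W \<xi> u) \<xi>))"


section \<open>Standing assumptions\<close>

definition assumption_A :: "(complex ^ 'd) set \<Rightarrow> (complex ^ 'd \<Rightarrow> complex ^ 'd::finite) \<Rightarrow> bool"
  where "assumption_A Q \<omega>\<^sub>0 \<longleftrightarrow>
    complex_analytic_on \<omega>\<^sub>0 Q \<and> (\<forall>\<xi>\<in>Q \<inter> range cvec. \<omega>\<^sub>0 \<xi> \<in> range cvec)"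

text \<open>The second bound is on the inverse \<open>(\<partial>\<^sub>\<xi> \<omega>\<^sub>0)\<^sup>-\<^sup>1\<close> of the Jacobian.\<close>

definition assumption_B :: "real \<Rightarrow> (complex ^ 'd) set \<Rightarrow> (complex ^ 'd \<Rightarrow> complex ^ 'd::finite) \<Rightarrow> bool"
  where "assumption_B C Q \<omega>\<^sub>0 \<longleftrightarrow>
    (SUP \<xi>\<in>Q. ennreal (onorm (frechet_derivative \<omega>\<^sub>0 (at \<xi>)))) < ennreal C \<and>
    (\<forall>\<xi>\<in>Q. bij (frechet_derivative \<omega>\<^sub>0 (at \<xi>))) \<and>
    (SUP \<xi>\<in>Q. ennreal (onorm (inv (frechet_derivative \<omega>\<^sub>0 (at \<xi>))))) < ennreal C"

definition assumption_C ::
    "real \<Rightarrow> real \<Rightarrow> (complex ^ 'd) set \<Rightarrow> (complex ^ 'd \<Rightarrow> ('d::finite, 'n::finite) phase \<Rightarrow> complex) \<Rightarrow> bool"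
  where "assumption_C s\<^sub>0 r\<^sub>0 Q P\<^sub>0 \<longleftrightarrow>
    (\<forall>\<xi>\<in>Q. complex_analytic_on (P\<^sub>0 \<xi>) (cdom s\<^sub>0 r\<^sub>0) \<and>
       (\<forall>u\<in>cdom s\<^sub>0 r\<^sub>0. \<forall>v\<in>cdom s\<^sub>0 r\<^sub>0. same_point u v \<longrightarrow> P\<^sub>0 \<xi> u = P\<^sub>0 \<xi> v) \<and>
       complex_analytic_on (ham_vf (P\<^sub>0 \<xi>)) (cdom s\<^sub>0 r\<^sub>0)) \<and>
    (\<forall>\<xi>\<in>Q \<inter> range cvec. \<forall>u\<in>real_dom s\<^sub>0 r\<^sub>0. P\<^sub>0 \<xi> u \<in> \<real>) \<and>
    (\<forall>u\<in>cdom s\<^sub>0 r\<^sub>0. complex_analytic_on (\<lambda>\<xi>. ham_vf (P\<^sub>0 \<xi>) u) Q) \<and>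
    (\<forall>u\<in>real_dom s\<^sub>0 r\<^sub>0. \<forall>\<xi>\<in>Q \<inter> range cvec. ham_vf (P\<^sub>0 \<xi>) u \<in> real_points)"

definition assumption_D ::
    "real \<Rightarrow> real \<Rightarrow> (real ^ 'd) set \<Rightarrow> (complex ^ 'd \<Rightarrow> ('d::finite, 'n::finite) phase \<Rightarrow> complex) \<Rightarrow> bool"
  where "assumption_D s\<^sub>0 r\<^sub>0 \<Pi>\<^sub>0 P\<^sub>0 \<longleftrightarrow>
    (\<forall>u\<in>real_dom s\<^sub>0 r\<^sub>0. \<forall>\<xi>\<in>\<Pi>\<^sub>0. cnj (P\<^sub>0 (cvec \<xi>) u) = P\<^sub>0 (cvec \<xi>) u)"

definition hamiltonian ::
    "real ^ 'n \<Rightarrow> (complex ^ 'd \<Rightarrow> complex ^ 'd) \<Rightarrow> (complex ^ 'd \<Rightarrow> ('d, 'n) phase \<Rightarrow> complex) \<Rightarrow>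
     complex ^ 'd \<Rightarrow> ('d::finite, 'n::finite) phase \<Rightarrow> complex"
  where "hamiltonian \<Omega> \<omega>\<^sub>0 P\<^sub>0 \<xi> = (\<lambda>(x, y, z, zb).
    bil (\<omega>\<^sub>0 \<xi>) y + bil (diag \<Omega> *v z) zb + P\<^sub>0 \<xi> (x, y, z, zb))"


section \<open>Perturbed invariant tori\<close>

text \<open>\<open>\<Phi>\<close> is the lift of a map of the quotient phase space: in the last but one line, one
  direction says that it descends to the quotient and the other that the descended map is
  injective.\<close>

definition real_analytic_symplectic ::
    "real \<Rightarrow> real \<Rightarrow> (('d::finite, 'n::finite) phase \<Rightarrow> ('d, 'n) phase) \<Rightarrow> bool"
  where "real_analytic_symplectic s r \<Phi> \<longleftrightarrow>
    complex_analytic_on \<Phi> (cdom s r) \<and>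
    \<Phi> ` real_dom s r \<subseteq> real_points \<and>
    (\<forall>u\<in>cdom s r. \<forall>v\<in>cdom s r. same_point (\<Phi> u) (\<Phi> v) \<longleftrightarrow> same_point u v) \<and>
    (\<forall>u\<in>cdom s r. \<forall>h k. sympl (frechet_derivative \<Phi> (at u) h) (frechet_derivative \<Phi> (at u) k) = sympl h k)"

text \<open>The remainder estimate is for the real phase space, where \<open>norm zb = norm z\<close>.
  No reality or symmetry of \<open>B\<close> is imposed.\<close>

definition normal_form_at_torus ::
    "real ^ 'n \<Rightarrow> real \<Rightarrow> real \<Rightarrow> (('d, 'n) phase \<Rightarrow> complex) \<Rightarrow>
     real ^ 'd \<Rightarrow> (complex ^ 'd \<Rightarrow> complex ^ 'n ^ 'n) \<Rightarrow> (('d::finite, 'n::finite) phase \<Rightarrow> ('d, 'n) phase) \<Rightarrow> bool"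
  where "normal_form_at_torus \<Omega> s\<^sub>0 r\<^sub>0 H \<omega> B \<Phi> \<longleftrightarrow>
    complex_analytic_on B (strip (s\<^sub>0 / 2)) \<and>
    (\<forall>x\<in>strip (s\<^sub>0 / 2). \<forall>x'\<in>strip (s\<^sub>0 / 2). same_angle x x' \<longrightarrow> B x = B x') \<and>
    (\<exists>s>0. \<exists>r>0. real_analytic_symplectic s r \<Phi> \<and> \<Phi> ` cdom s r \<subseteq> cdom s\<^sub>0 r\<^sub>0 \<and>
      (\<exists>c M. \<forall>(x, y, z, zb)\<in>real_dom s r.
        norm (H (\<Phi> (x, y, z, zb)) -
              (c + bil (cvec \<omega>) y + bil (diag \<Omega> *v z) zb + bil (B x *v z) zb))
          \<le> M * (norm y * norm z + (norm y)\<^sup>2 + (norm z) ^ 3)))"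

definition perturbed_tori ::
    "real \<Rightarrow> real \<Rightarrow> real ^ 'n \<Rightarrow> real \<Rightarrow> real \<Rightarrow> (real ^ 'd) set \<Rightarrow>
     (complex ^ 'd \<Rightarrow> ('d, 'n) phase \<Rightarrow> complex) \<Rightarrow> (real ^ 'd) set \<Rightarrow>
     (real ^ 'd \<Rightarrow> real ^ 'd) \<Rightarrow> (real ^ 'd \<Rightarrow> complex ^ 'd \<Rightarrow> complex ^ 'n ^ 'n) \<Rightarrow>
     (real ^ 'd \<Rightarrow> ('d::finite, 'n::finite) phase \<Rightarrow> ('d, 'n) phase) \<Rightarrow> bool"
  where "perturbed_tori K \<epsilon> \<Omega> s\<^sub>0 r\<^sub>0 \<Pi>\<^sub>0 H \<Pi>\<^sub>i\<^sub>n\<^sub>f \<omega>\<^sub>s B \<Phi> \<longleftrightarrow>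
    \<Pi>\<^sub>i\<^sub>n\<^sub>f \<subseteq> \<Pi>\<^sub>0 \<and> \<Pi>\<^sub>i\<^sub>n\<^sub>f \<in> sets lebesgue \<and>
    measure lebesgue \<Pi>\<^sub>i\<^sub>n\<^sub>f \<ge> (1 - K * \<epsilon> powr (1/2)) * measure lebesgue \<Pi>\<^sub>0 \<and>
    (\<forall>\<xi>\<in>\<Pi>\<^sub>i\<^sub>n\<^sub>f. normal_form_at_torus \<Omega> s\<^sub>0 r\<^sub>0 (H (cvec \<xi>)) (\<omega>\<^sub>s \<xi>) (B \<xi>) (\<Phi> \<xi>))"


section \<open>Linearized equation and Lyapunov exponents\<close>

definition linearized_solution ::
    "real ^ 'n \<Rightarrow> real ^ 'd \<Rightarrow> (complex ^ 'd \<Rightarrow> complex ^ 'n ^ 'n) \<Rightarrow>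
     (real \<Rightarrow> real ^ 'd) \<Rightarrow> (real \<Rightarrow> real ^ 'd) \<Rightarrow> (real \<Rightarrow> complex ^ 'n) \<Rightarrow> (real \<Rightarrow> complex ^ 'n) \<Rightarrow> bool"
  where "linearized_solution \<Omega> \<omega> B x y z zb \<longleftrightarrow>
    (\<forall>t\<ge>0.
      (x has_vector_derivative \<omega>) (at t within {0..}) \<and>
      (y has_vector_derivative 0) (at t within {0..}) \<and>
      (z has_vector_derivative
        scaleC \<i> ((diag \<Omega> + B (cvec (x t))) *v z t)) (at t within {0..}) \<and>
      (zb has_vector_derivative
        - scaleC \<i> ((diag \<Omega> + B (cvec (x t))) *v zb t)) (at t within {0..}))"

definition lyapunov_exponent :: "(real \<Rightarrow> 'a::real_normed_vector) \<Rightarrow> ereal"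
  where "lyapunov_exponent v = Limsup at_top (\<lambda>t. ereal (ln (norm (v t)) / t))"

text \<open>The exponents of the solutions with nonzero displacement \<open>(y, z, zb)\<close> from the torus; the
  angle \<open>x\<close> is the base point moving on the torus.\<close>

definition lyapunov_exponents ::
    "real ^ 'n \<Rightarrow> real ^ 'd \<Rightarrow> (complex ^ 'd \<Rightarrow> complex ^ 'n ^ 'n) \<Rightarrow> ereal set"
  where "lyapunov_exponents \<Omega> \<omega> B =
    {lyapunov_exponent (\<lambda>t. (y t, z t, zb t)) | x y z zb.
      linearized_solution \<Omega> \<omega> B x y z zb \<and> (y 0, z 0, zb 0) \<noteq> 0}"

end

(* Along the normal form the Hamiltonian is real on real points, so on letting z tend to 0 the
   remainder O(|z|^3) forces the quadratic form of Omega + B(x) to be real for real x.  Hence the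
   generator of the linearized flow is skew, and |y|, |z|, |zb| are constant along solutions. *)
theory Submission
  imports Defs
begin

lemma cvec_0 [simp]: "cvec 0 = 0"
  by (simp add: cvec_def vec_eq_iff)

lemma cvec_in_strip [simp]: "s > 0 \<Longrightarrow> cvec x \<in> strip s"
  by (simp add: cvec_def strip_def)

lemma norm_cnj_vec [simp]: "norm (cnj_vec v) = norm v"
  by (simp add: cnj_vec_def norm_vec_def)

lemma Im_bil_cvec [simp]: "Im (bil (cvec v) (cvec w)) = 0"
  by (simp add: bil_def cvec_def)

lemma bil_add_left: "bil (u + v) w = bil u w + bil v w"
  by (simp add: bil_def algebra_simps sum.distrib)

lemma bil_0_right [simp]: "bil u 0 = 0"
  by (simp add: bil_def)

lemma diag_mult_vec: "diag \<Omega> *v z = (\<chi> k. complex_of_real (\<Omega> $ k) * z $ k)"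
  by (simp add: diag_def matrix_vector_mult_def vec_eq_iff if_distrib[where f = "\<lambda>c. c * _"] cong: if_cong)

lemma Im_bil_diag_cnj [simp]: "Im (bil (diag \<Omega> *v z) (cnj_vec z)) = 0"
  by (simp add: diag_mult_vec bil_def cnj_vec_def algebra_simps)

text \<open>Real scalars pass through \<open>A\<close> and commute with conjugation, so each
  argument contributes one factor. This homogeneity is what lets the quadratic term be compared with
  the cubic remainder along a ray.\<close>

lemma bil_scaleR_cnj:
  fixes A :: "complex ^ 'n ^ 'n"
  shows "bil (A *v (\<tau> *\<^sub>R z)) (cnj_vec (\<tau> *\<^sub>R z)) = \<tau>\<^sup>2 *\<^sub>R bil (A *v z) (cnj_vec z)"
proof -
  have "A *v (\<tau> *\<^sub>R z) = \<tau> *\<^sub>R (A *v z)"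
    by (simp add: matrix_vector_mult_def vec_eq_iff scaleR_sum_right)
  then show ?thesis
    by (simp add: bil_def cnj_vec_def scaleR_sum_right power2_eq_square)
qed

text \<open>The real inner product on complex vectors is the real part of the Hermitian one, and
  multiplication by i turns a real part into minus an imaginary part. This translates reality of a
  quadratic form into orthogonality of \<open>z\<close> to its velocity.\<close>

lemma inner_scaleC_ii: "z \<bullet> scaleC \<i> w = - Im (bil w (cnj_vec z))"
  by (simp add: inner_vec_def inner_complex_def scaleC_vec_def scaleC_complex_def bil_def
      cnj_vec_def flip: sum_negf) (simp add: algebra_simps)

text \<open>Each summand is real separately: the frequency vector by \<open>assumption_A\<close>,
  since \<open>cvec \<xi>\<close> is a real point of the parameter domain; the oscillator part
  because it is a real combination of the squared moduli of the \<open>z\<close> components; the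
  perturbation by \<open>assumption_D\<close>.\<close>

lemma hamiltonian_real:
  assumes "assumption_A (param_dom \<rho> S) \<omega>\<^sub>0" and "assumption_D s r S P\<^sub>0"
    and "\<xi> \<in> S" and "\<rho> > 0" and "u \<in> real_dom s r"
  shows "Im (hamiltonian \<Omega> \<omega>\<^sub>0 P\<^sub>0 (cvec \<xi>) u) = 0"
proof -
  obtain x y z zb where u: "u = (x, y, z, zb)" by (metis prod_cases4)
  have "cvec \<xi> \<in> param_dom \<rho> S"
    using assms(3,4) by (auto simp: param_dom_def intro!: bexI[of _ \<xi>])
  then obtain w where w: "\<omega>\<^sub>0 (cvec \<xi>) = cvec w"
    using assms(1) by (auto simp: assumption_A_def)
  obtain y' where y': "y = cvec y'" and zb: "zb = cnj_vec z"
    using assms(5) by (auto simp: u real_dom_def real_points_def)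
  have "cnj (P\<^sub>0 (cvec \<xi>) u) = P\<^sub>0 (cvec \<xi>) u"
    using assms(2,3,5) by (auto simp: assumption_D_def)
  then have "Im (P\<^sub>0 (cvec \<xi>) u) = 0" by (simp add: complex_eq_iff)
  then show ?thesis by (simp add: u hamiltonian_def w y' zb)
qed

text \<open>Dividing by the square of \<tau> leaves a bound linear in \<tau>, which vanishes as
  \<tau> decreases to 0.\<close>

lemma cubic_bound_imp_zero:
  fixes q M r :: real
  assumes "r > 0" and bound: "\<And>\<tau>. 0 < \<tau> \<Longrightarrow> \<tau> < r \<Longrightarrow> \<tau>\<^sup>2 * \<bar>q\<bar> \<le> M * \<tau> ^ 3"
  shows "q = 0"
proof -
  have "eventually (\<lambda>\<tau>. \<bar>q\<bar> \<le> M * \<tau>) (at_right 0)"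
    using eventually_at_right_real[OF assms(1)]
  proof eventually_elim
    case (elim \<tau>)
    then have "\<tau>\<^sup>2 * \<bar>q\<bar> \<le> \<tau>\<^sup>2 * (M * \<tau>)"
      using bound[of \<tau>] by (simp add: power2_eq_square power3_eq_cube mult_ac)
    then show ?case using elim by simp
  qed
  moreover have "((\<lambda>\<tau>. M * \<tau>) \<longlongrightarrow> 0) (at_right 0)"
    by (auto intro!: tendsto_eq_intros)
  ultimately have "\<bar>q\<bar> \<le> 0"
    by (intro tendsto_lowerbound[where f = "\<lambda>\<tau>. M * \<tau>" and F = "at_right 0"]) auto
  then show ?thesis by simp
qed

lemma normal_form_quadratic_part_real:
  fixes B :: "complex ^ 'd::finite \<Rightarrow> complex ^ 'n::finite ^ 'n"
  assumes nf: "normal_form_at_torus \<Omega> s\<^sub>0 r\<^sub>0 H \<omega> B \<Phi>"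
    and real: "\<And>u. u \<in> real_dom s\<^sub>0 r\<^sub>0 \<Longrightarrow> Im (H u) = 0"
  shows "Im (bil ((diag \<Omega> + B (cvec x)) *v z) (cnj_vec z)) = 0"
proof -
  obtain s r c M where "s > 0" "r > 0"
    and sym: "real_analytic_symplectic s r \<Phi>" and sub: "\<Phi> ` cdom s r \<subseteq> cdom s\<^sub>0 r\<^sub>0"
    and est: "\<forall>(x, y, z, zb)\<in>real_dom s r.
        norm (H (\<Phi> (x, y, z, zb)) -
              (c + bil (cvec \<omega>) y + bil (diag \<Omega> *v z) zb + bil (B x *v z) zb))
          \<le> M * (norm y * norm z + (norm y)\<^sup>2 + (norm z) ^ 3)"
    using nf unfolding normal_form_at_torus_def by blast
  define Q where "Q z = bil (B (cvec x) *v z) (cnj_vec z)" for z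
  \<comment> \<open>The test points have \<open>y = 0\<close>: this removes the frequency term and
    reduces the remainder to its cubic part. The witness 0 exhibits \<open>y\<close> as
    \<open>cvec 0\<close>.\<close>
  have mem: "(cvec x, 0, v, cnj_vec v) \<in> real_dom s r" if "norm v < r" for v :: "complex ^ 'n"
    using that \<open>s > 0\<close> \<open>r > 0\<close>
    by (auto simp: real_dom_def cdom_def real_points_def intro!: range_eqI[of _ _ 0])
  \<comment> \<open>\<Phi> sends real points to real points, so \<open>H\<close> is real at the
    image; the \<Omega> term is real as well. Only \<open>c\<close> and \<open>Q v\<close> can
    contribute to the imaginary part.\<close>
  have est': "\<bar>Im c + Im (Q v)\<bar> \<le> M * norm v ^ 3" if "norm v < r" for v
  proof -
    let ?u = "(cvec x, 0, v, cnj_vec v) :: ('d, 'n) phase"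
    have "\<Phi> ?u \<in> real_dom s\<^sub>0 r\<^sub>0"
      using mem[OF that] sym sub by (auto simp: real_analytic_symplectic_def real_dom_def)
    then have "Im (H (\<Phi> ?u)) = 0" by (rule real)
    moreover have "norm (H (\<Phi> ?u) - (c + bil (diag \<Omega> *v v) (cnj_vec v) + Q v)) \<le> M * norm v ^ 3"
      using est mem[OF that] by (force simp: Q_def)
    ultimately show ?thesis
      using abs_Im_le_cmod[of "H (\<Phi> ?u) - (c + bil (diag \<Omega> *v v) (cnj_vec v) + Q v)"] by simp
  qed
  \<comment> \<open>Homogeneity with scaling factor 0. On the torus itself the remainder vanishes,
    which then makes the additive constant real.\<close>
  have "Q 0 = 0" using bil_scaleR_cnj[of "B (cvec x)" 0 z] by (simp add: Q_def)
  then have c: "Im c = 0" using est'[of 0] \<open>r > 0\<close> by simp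
  have Q_scaleR: "Im (Q (\<tau> *\<^sub>R z)) = \<tau>\<^sup>2 * Im (Q z)" for \<tau>
    by (simp add: Q_def bil_scaleR_cnj)
  have "Im (Q z) = 0"
  proof (cases "z = 0")
    case False
    show ?thesis
    \<comment> \<open>The range of \<tau> keeps \<open>\<tau> *\<^sub>R z\<close> inside the ball of
      radius \<open>r\<close>; the new constant absorbs the cube of \<open>norm z\<close>.\<close>
    proof (rule cubic_bound_imp_zero[of "r / norm z" _ "M * norm z ^ 3"])
      show "r / norm z > 0" using False \<open>r > 0\<close> by simp
      fix \<tau> :: real assume "0 < \<tau>" "\<tau> < r / norm z"
      then show "\<tau>\<^sup>2 * \<bar>Im (Q z)\<bar> \<le> M * norm z ^ 3 * \<tau> ^ 3"
        using est'[of "\<tau> *\<^sub>R z"] False c Q_scaleR[of \<tau>]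
        by (simp add: field_simps abs_mult)
    qed
  qed (use \<open>Q 0 = 0\<close> in simp)
  then show ?thesis
    by (simp add: Q_def matrix_vector_mult_add_rdistrib bil_add_left)
qed

text \<open>The squared norm has derivative twice \<open>f t \<bullet> f' t\<close>, hence zero, and
  the half-line is convex. Derivatives within \<open>{0..}\<close> are one-sided at 0, matching
  \<open>linearized_solution\<close>.\<close>

lemma norm_const_if_derivative_orthogonal:
  fixes f :: "real \<Rightarrow> 'a::real_inner"
  assumes deriv: "\<And>t. t \<ge> 0 \<Longrightarrow> (f has_vector_derivative f' t) (at t within {0..})"
    and orth: "\<And>t. t \<ge> 0 \<Longrightarrow> f t \<bullet> f' t = 0" and "t \<ge> 0"
  shows "norm (f t) = norm (f 0)"
proof -
  have "((\<lambda>t. f t \<bullet> f t) has_derivative (\<lambda>h. 0)) (at t within {0..})" if "t \<in> {0..}" for t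
  proof -
    have "((\<lambda>t. f t \<bullet> f t) has_derivative (\<lambda>h. f t \<bullet> (h *\<^sub>R f' t) + (h *\<^sub>R f' t) \<bullet> f t)) (at t within {0..})"
      using deriv[of t] that unfolding has_vector_derivative_def
      by (intro has_derivative_inner) auto
    then show ?thesis using orth[of t] that by (simp add: inner_commute)
  qed
  then obtain k where "\<And>t. t \<in> {0..} \<Longrightarrow> f t \<bullet> f t = k"
    using has_derivative_zero_constant[of "{0::real..}" "\<lambda>t. f t \<bullet> f t"] by auto
  then show ?thesis using assms(3) by (simp add: norm_eq_sqrt_inner)
qed

text \<open>A fixed numerator divided by \<open>t\<close> tends to 0, and the upper limit agrees
  with the limit. For \<open>k = 0\<close> the total function \<open>ln\<close> still returns a
  fixed real, so the same argument applies.\<close>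

lemma lyapunov_exponent_norm_const:
  assumes "\<And>t. t \<ge> 0 \<Longrightarrow> norm (v t) = k"
  shows "lyapunov_exponent v = 0"
proof -
  have "((\<lambda>t::real. ln k / t) \<longlongrightarrow> 0) at_top"
    by (intro real_tendsto_divide_at_top[OF tendsto_const] filterlim_ident)
  moreover have "eventually (\<lambda>t. ln k / t = ln (norm (v t)) / t) at_top"
    using eventually_ge_at_top[of 0] by eventually_elim (simp add: assms)
  ultimately have "((\<lambda>t. ln (norm (v t)) / t) \<longlongrightarrow> 0) at_top"
    by (rule Lim_transform_eventually)
  then have "((\<lambda>t. ereal (ln (norm (v t)) / t)) \<longlongrightarrow> ereal 0) at_top"
    by simp
  then show ?thesis
    unfolding lyapunov_exponent_def by (simp add: lim_imp_Limsup zero_ereal_def)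
qed

text \<open>Each component conserves its own norm. The angle \<open>x t\<close> stays real, so the
  reality hypothesis makes the velocities of \<open>z\<close> and \<open>zb\<close> orthogonal to
  \<open>z\<close> and \<open>zb\<close>; the opposite sign in the second equation preserves
  orthogonality.\<close>

lemma linearized_solution_norm_const:
  assumes sol: "linearized_solution \<Omega> \<omega> B x y z zb"
    and real: "\<And>x z. Im (bil ((diag \<Omega> + B (cvec x)) *v z) (cnj_vec z)) = 0" and "t \<ge> 0"
  shows "norm (y t, z t, zb t) = norm (y 0, z 0, zb 0)"
proof -
  have "norm (y t) = norm (y 0)"
    using sol \<open>t \<ge> 0\<close> unfolding linearized_solution_def
    by (intro norm_const_if_derivative_orthogonal[where f' = "\<lambda>_. 0"]) auto
  moreover have "norm (z t) = norm (z 0)"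
    using sol \<open>t \<ge> 0\<close> unfolding linearized_solution_def
    by (intro norm_const_if_derivative_orthogonal
        [where f' = "\<lambda>t. scaleC \<i> ((diag \<Omega> + B (cvec (x t))) *v z t)"])
      (auto simp: inner_scaleC_ii real)
  moreover have "norm (zb t) = norm (zb 0)"
    using sol \<open>t \<ge> 0\<close> unfolding linearized_solution_def
    by (intro norm_const_if_derivative_orthogonal
        [where f' = "\<lambda>t. - scaleC \<i> ((diag \<Omega> + B (cvec (x t))) *v zb t)"])
      (auto simp: inner_scaleC_ii real)
  ultimately show ?thesis by (simp add: norm_Pair)
qed

text \<open>Rotation on the torus with a frozen action displacement: with \<open>z\<close> and
  \<open>zb\<close> at 0 the coefficient \<open>B\<close> drops out. It serves to show that the set
  of exponents is nonempty.\<close>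

lemma linearized_solution_exists:
  "linearized_solution \<Omega> \<omega> B (\<lambda>t. t *\<^sub>R \<omega>) (\<lambda>_. y\<^sub>0) (\<lambda>_. 0) (\<lambda>_. 0)"
proof -
  have "scaleC \<i> (0 :: complex ^ 'n) = 0"
    by (simp add: scaleC_vec_def scaleC_complex_def vec_eq_iff)
  then show ?thesis
    unfolding linearized_solution_def by (auto intro!: derivative_eq_intros)
qed

lemma lyapunov_exponents_eq_0:
  fixes \<omega> :: "real ^ 'd::finite"
  assumes "\<And>x z. Im (bil ((diag \<Omega> + B (cvec x)) *v z) (cnj_vec z)) = 0"
  shows "lyapunov_exponents \<Omega> \<omega> B = {0}"
proof -
  have zero: "lyapunov_exponent (\<lambda>t. (y t, z t, zb t)) = 0"
    if "linearized_solution \<Omega> \<omega> B x y z zb" for x y z zb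
    using linearized_solution_norm_const[OF that assms] by (rule lyapunov_exponent_norm_const)
  \<comment> \<open>Equality with \<open>{0}\<close> also requires 0 to be attained. The
    displacement \<open>vec 1\<close> in the action direction is nonzero because the index type is
    nonempty.\<close>
  have "((vec 1 :: real ^ 'd), (0 :: complex ^ 'n), (0 :: complex ^ 'n)) \<noteq> 0"
    by (simp add: prod_eq_iff vec_eq_iff)
  then have "0 \<in> lyapunov_exponents \<Omega> \<omega> B"
    using linearized_solution_exists[of \<Omega> \<omega> B "vec 1"]
      zero[OF linearized_solution_exists[of \<Omega> \<omega> B "vec 1"]]
    unfolding lyapunov_exponents_def by fastforce
  then show ?thesis using zero unfolding lyapunov_exponents_def by blast
qed

theorem corollary1:
  fixes a b :: "real ^ 'd::finite" and r\<^sub>0 s\<^sub>0 \<rho>\<^sub>0 C K :: real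
  assumes "\<And>j. a $ j < b $ j" and "r\<^sub>0 > 0" and "s\<^sub>0 > 0" and "\<rho>\<^sub>0 > 0" and "C > 0" and "K > 0"
  shows "\<exists>\<epsilon>\<^sub>s>0. \<forall>\<epsilon>. 0 < \<epsilon> \<and> \<epsilon> < \<epsilon>\<^sub>s \<longrightarrow>
    (\<forall>(\<Omega> :: real ^ 'n::finite) \<omega>\<^sub>0 P\<^sub>0.
      (\<forall>k. \<Omega> $ k > 0) \<and>
      assumption_A (param_dom \<rho>\<^sub>0 (box a b)) \<omega>\<^sub>0 \<and>
      assumption_B C (param_dom \<rho>\<^sub>0 (box a b)) \<omega>\<^sub>0 \<and>
      assumption_C s\<^sub>0 r\<^sub>0 (param_dom \<rho>\<^sub>0 (box a b)) P\<^sub>0 \<and>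
      assumption_D s\<^sub>0 r\<^sub>0 (box a b) P\<^sub>0 \<and>
      sup_norm_vf r\<^sub>0 (\<lambda>\<xi>. ham_vf (P\<^sub>0 \<xi>)) (cdom s\<^sub>0 r\<^sub>0) (param_dom \<rho>\<^sub>0 (box a b))
        < ennreal \<epsilon> \<and>
      sup_deriv_norm_vf r\<^sub>0 (\<lambda>\<xi>. ham_vf (P\<^sub>0 \<xi>)) (cdom s\<^sub>0 r\<^sub>0) (param_dom \<rho>\<^sub>0 (box a b))
        < ennreal (\<epsilon> powr (1/3))
      \<longrightarrow>
      (\<forall>\<Pi>\<^sub>i\<^sub>n\<^sub>f \<omega>\<^sub>s B \<Phi>.
        perturbed_tori K \<epsilon> \<Omega> s\<^sub>0 r\<^sub>0 (box a b) (hamiltonian \<Omega> \<omega>\<^sub>0 P\<^sub>0) \<Pi>\<^sub>i\<^sub>n\<^sub>f \<omega>\<^sub>s B \<Phi>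
        \<longrightarrow> (\<forall>\<xi>\<in>\<Pi>\<^sub>i\<^sub>n\<^sub>f. lyapunov_exponents \<Omega> (\<omega>\<^sub>s \<xi>) (B \<xi>) = {0})))"
\<comment> \<open>The threshold 1 is an arbitrary positive witness: \<open>perturbed_tori\<close>
  supplies the normal forms, and the exponents are computed from them one parameter at a
  time.\<close>
proof (intro exI[of _ 1] conjI allI impI ballI; (elim conjE)?)
  fix \<Omega> :: "real ^ 'n" and \<omega>\<^sub>0 P\<^sub>0 \<epsilon> \<Pi>\<^sub>i\<^sub>n\<^sub>f \<omega>\<^sub>s B \<Phi> \<xi>
  assume A: "assumption_A (param_dom \<rho>\<^sub>0 (box a b)) \<omega>\<^sub>0"
    and D: "assumption_D s\<^sub>0 r\<^sub>0 (box a b) P\<^sub>0"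
    and tori: "perturbed_tori K \<epsilon> \<Omega> s\<^sub>0 r\<^sub>0 (box a b) (hamiltonian \<Omega> \<omega>\<^sub>0 P\<^sub>0) \<Pi>\<^sub>i\<^sub>n\<^sub>f \<omega>\<^sub>s B \<Phi>"
    and "\<xi> \<in> \<Pi>\<^sub>i\<^sub>n\<^sub>f"
  then have \<xi>: "\<xi> \<in> box a b"
    and nf: "normal_form_at_torus \<Omega> s\<^sub>0 r\<^sub>0 (hamiltonian \<Omega> \<omega>\<^sub>0 P\<^sub>0 (cvec \<xi>)) (\<omega>\<^sub>s \<xi>) (B \<xi>) (\<Phi> \<xi>)"
    by (auto simp: perturbed_tori_def)
  show "lyapunov_exponents \<Omega> (\<omega>\<^sub>s \<xi>) (B \<xi>) = {0}"
    by (intro lyapunov_exponents_eq_0 normal_form_quadratic_part_real[OF nf]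
        hamiltonian_real[OF A D \<xi> \<open>\<rho>\<^sub>0 > 0\<close>])
qed simp

end
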